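(* Let $n$ be a positive integer. Consider the equation $$x^2+y^4+z^4-2xy^2-2xz^2-2y^2z^2=n .$$ (a) If $n$ is not a perfect square, this equation has no rational solutions $(x,y,z)$ with $yz=0$. (b) If $n=k^2$, $k$ a positive integer, then all the rational solutions with $yz=0$ are the triples of the form $$(\pm k,0,0),\qquad (r^2\pm k,\pm r,0),\qquad (r^2\pm k,0,\pm r),$$ where $r$ is an arbitrary positive rational and any sign combination is possible. (c) All the rational solutions with $yz\ne 0$ can be parametrically described as follows: $$x=r^2+\frac{1}{16r^2}\left(\frac{n_1t_1}{t_2}-\frac{n_2t_2}{t_1}\right)^2\pm\frac12\left(\frac{n_1t_1}{t_2}+\frac{n_2t_2}{t_1}\right),$$ $$y=\pm r,\qquad z=\pm\frac{1}{4r}\left|\frac{n_1t_1}{t_2}-\frac{n_2t_2}{t_1}\right|,$$ where $r$ is an arbitrary positive rational, any sign combination is possible, and $n_1,t_1,n_2,t_2$ are positive integers such that $n_1n_2=n$, $\gcd(t_1,t_2)=1$ and $n_1t_1^2\ne n_2t_2^2$. *)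

theory Defs
  imports Complex_Main
begin

definition rational_solutions :: "nat \<Rightarrow> (rat \<times> rat \<times> rat) set" where
  "rational_solutions n =
     {(x, y, z). x^2 + y^4 + z^4 - 2*x*y^2 - 2*x*z^2 - 2*y^2*z^2 = of_nat n}"

end

theory Submission
  imports Defs
begin

text \<open>
  Completing the square in \<open>x\<close> turns the equation into
  \<open>(x - y\<^sup>2 - z\<^sup>2)\<^sup>2 - (2yz)\<^sup>2 = n\<close>.

  If \<open>yz = 0\<close>, this says that the rational number \<open>x - y\<^sup>2 - z\<^sup>2\<close> is a square root of the natural
  number \<open>n\<close>; such a root is an integer, which gives both the impossibility for non-squares
  and the list \<open>x = y\<^sup>2 + z\<^sup>2 \<plusminus> k\<close> for \<open>n = k\<^sup>2\<close>.

  If \<open>yz \<noteq> 0\<close>, the difference of squares factors as \<open>A B = n\<close>, where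
  \<open>A = \<bar>x - y\<^sup>2 - z\<^sup>2\<bar> + 2\<bar>yz\<bar>\<close> and \<open>B = \<bar>x - y\<^sup>2 - z\<^sup>2\<bar> - 2\<bar>yz\<bar>\<close> are distinct positive rationals.
  Writing \<open>A = n\<^sub>1t\<^sub>1/t\<^sub>2\<close> and \<open>B = n\<^sub>2t\<^sub>2/t\<^sub>1\<close> and solving for \<open>x\<close> and \<open>\<bar>z\<bar>\<close> in terms of \<open>r = \<bar>y\<bar>\<close> gives
  the parametrization. It reaches a solution in several ways; the simplest choice for a given pair
  \<open>A, B\<close> is \<open>n\<^sub>1 = n\<close>, \<open>n\<^sub>2 = 1\<close> and \<open>t\<^sub>1/t\<^sub>2\<close> the reduced form of \<open>A/n\<close>.
\<close>

section \<open>The equation as a difference of squares\<close>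

lemma rational_solutions_iff_difference_of_squares:
  "(x, y, z) \<in> rational_solutions n \<longleftrightarrow> (x - y^2 - z^2)^2 - (2 * (y * z))^2 = of_nat n"
proof -
  have "x^2 + y^4 + z^4 - 2*x*y^2 - 2*x*z^2 - 2*y^2*z^2 = (x - y^2 - z^2)^2 - (2 * (y * z))^2"
    by algebra
  then show ?thesis
    by (simp add: rational_solutions_def)
qed

section \<open>Square roots and solutions with \<open>yz = 0\<close>\<close>

lemma pos_rat_reduced_fraction:
  fixes q :: rat
  assumes "q > 0"
  obtains a b :: nat where "a > 0" "b > 0" "coprime a b" "q = of_nat a / of_nat b"
proof -
  obtain c d :: int where cd: "quotient_of q = (c, d)"
    by fastforce
  have d: "d > 0" and cop: "coprime c d" and q: "q = of_int c / of_int d"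
    using cd quotient_of_denom_pos quotient_of_coprime quotient_of_div by blast+
  have c: "c > 0"
    using assms d unfolding q by (simp add: zero_less_divide_iff)
  show thesis
  proof
    show "nat c > 0" "nat d > 0"
      using c d by simp_all
    show "coprime (nat c) (nat d)"
      using c d cop by (simp add: coprime_int_iff [symmetric])
    show "q = of_nat (nat c) / of_nat (nat d)"
      using c d q by simp
  qed
qed

text \<open>
  In lowest terms \<open>w = \<plusminus>a/b\<close>, the equation \<open>a\<^sup>2 = n b\<^sup>2\<close> makes \<open>b\<^sup>2\<close> a divisor of the coprime \<open>a\<^sup>2\<close>, so
  \<open>b = 1\<close>.
\<close>

lemma nat_eq_square_if_rat_square:
  fixes w :: rat
  assumes "w^2 = of_nat n"
  shows "\<exists>k::nat. n = k^2"
proof (cases "w = 0")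
  case True
  then show ?thesis
    using assms by auto
next
  case False
  then obtain a b :: nat where ab: "b > 0" "coprime a b" "\<bar>w\<bar> = of_nat a / of_nat b"
    using pos_rat_reduced_fraction [of "\<bar>w\<bar>"] by (metis zero_less_abs_iff)
  have "(of_nat a / of_nat b)^2 = (of_nat n :: rat)"
    using assms ab(3) by (metis power2_abs)
  then have "of_nat (a^2) = (of_nat (n * b^2) :: rat)"
    using ab(1) by (simp add: field_simps)
  then have eq: "a^2 = n * b^2"
    by (simp only: of_nat_eq_iff)
  then have "b^2 dvd a^2"
    by simp
  moreover have "coprime (a^2) (b^2)"
    using ab(2) by simp
  ultimately have "is_unit (b^2)"
    by (metis coprime_common_divisor dvd_refl)
  then show ?thesis
    using eq by auto
qed

lemma rational_solutions_square_axis_iff: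
  assumes "y * z = 0"
  shows "(x, y, z) \<in> rational_solutions (k^2) \<longleftrightarrow>
    x = y^2 + z^2 + of_nat k \<or> x = y^2 + z^2 - of_nat k"
proof -
  have "(x, y, z) \<in> rational_solutions (k^2) \<longleftrightarrow> (x - y^2 - z^2)^2 = (of_nat k)^2"
    by (simp only: rational_solutions_iff_difference_of_squares assms) simp
  also have "\<dots> \<longleftrightarrow> x = y^2 + z^2 + of_nat k \<or> x = y^2 + z^2 - of_nat k"
    by (auto simp: power2_eq_iff algebra_simps)
  finally show ?thesis .
qed

section \<open>Factorizations and solutions with \<open>yz \<noteq> 0\<close>\<close>

text \<open>
  The factors of \<open>n\<close> are \<open>A = \<bar>w\<bar> + \<bar>v\<bar>\<close> and \<open>B = \<bar>w\<bar> - \<bar>v\<bar>\<close>. The reduced form of \<open>A/n\<close> supplies \<open>t\<^sub>1/t\<^sub>2\<close>,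
  and then \<open>n\<close> cancels in \<open>B = n/A = t\<^sub>2/t\<^sub>1\<close>; so the whole of \<open>n\<close> goes into the first factor.
\<close>

lemma difference_of_squares_factors:
  fixes v w :: rat
  assumes "n > 0" "w^2 - v^2 = of_nat n" "v \<noteq> 0"
  obtains t1 t2 :: nat where
    "t1 > 0" "t2 > 0" "coprime t1 t2" "n * t1^2 \<noteq> t2^2"
    "\<bar>w\<bar> = (of_nat n * of_nat t1 / of_nat t2 + of_nat t2 / of_nat t1) / 2"
    "\<bar>v\<bar> = \<bar>of_nat n * of_nat t1 / of_nat t2 - of_nat t2 / of_nat t1\<bar> / 2"
proof -
  define A where "A = \<bar>w\<bar> + \<bar>v\<bar>"
  define B where "B = \<bar>w\<bar> - \<bar>v\<bar>"
  have A: "A > 0"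
    using assms(3) by (simp add: A_def add_nonneg_pos)
  have "A * B = \<bar>w\<bar>^2 - \<bar>v\<bar>^2"
    unfolding A_def B_def by algebra
  then have AB: "A * B = of_nat n"
    using assms(2) by simp
  obtain t1 t2 :: nat where t: "t1 > 0" "t2 > 0" "coprime t1 t2" "A / of_nat n = of_nat t1 / of_nat t2"
    using pos_rat_reduced_fraction [of "A / of_nat n"] A assms(1) by auto
  have A_eq: "A = of_nat n * of_nat t1 / of_nat t2"
    using t(4) assms(1) by (simp add: field_simps)
  have "B = of_nat n / A"
    using AB A by (simp add: field_simps)
  then have B_eq: "B = of_nat t2 / of_nat t1"
    using A_eq assms(1) by simp
  have "n * t1^2 \<noteq> t2^2"
  proof
    assume "n * t1^2 = t2^2"
    then have "of_nat n * (of_nat t1)^2 = (of_nat t2 :: rat)^2"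
      by (metis of_nat_mult of_nat_power)
    then have "A = B"
      using t(1,2) unfolding A_eq B_eq by (simp add: field_simps power2_eq_square)
    then show False
      using assms(3) by (simp add: A_def B_def)
  qed
  moreover have "\<bar>w\<bar> = (A + B) / 2" "\<bar>v\<bar> = \<bar>A - B\<bar> / 2"
    by (simp_all add: A_def B_def)
  ultimately show thesis
    using that t(1-3) unfolding A_eq B_eq by blast
qed

text \<open>
  Conversely, any factorization \<open>A B = n\<close> yields solutions, by
  \<open>((A + B)/2)\<^sup>2 - ((A - B)/2)\<^sup>2 = A B\<close>: the value of \<open>z\<close> is chosen to make \<open>2yz = \<plusminus>(A - B)/2\<close>.
\<close>

lemma factors_give_rational_solution:
  fixes r s s' s'' A B :: rat
  assumes "r > 0" "s \<in> {1, -1}" "s' \<in> {1, -1}" "s'' \<in> {1, -1}" "A * B = of_nat n"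
  shows "(r^2 + 1 / (16 * r^2) * (A - B)^2 + s * (1 / 2) * (A + B),
      s' * r, s'' * (1 / (4 * r)) * \<bar>A - B\<bar>) \<in> rational_solutions n"
proof -
  have sq: "s^2 = 1" "s'^2 = 1" "s''^2 = 1"
    using assms(2-4) by auto
  define y z where "y = s' * r" and "z = s'' * (1 / (4 * r)) * \<bar>A - B\<bar>"
  have y2: "y^2 = r^2"
    by (simp add: y_def power_mult_distrib sq)
  have z2: "z^2 = 1 / (16 * r^2) * (A - B)^2"
    by (simp add: z_def power_mult_distrib power_divide sq)
  have "(2 * (y * z))^2 = ((A - B) / 2)^2"
    using assms(1) by (simp add: power_mult_distrib y2 z2 power_divide)
  moreover have "(s * (1 / 2) * (A + B))^2 = ((A + B) / 2)^2"
    by (simp add: power_mult_distrib power_divide sq)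
  moreover have "((A + B) / 2)^2 - ((A - B) / 2)^2 = A * B"
    by (simp add: power2_eq_square field_simps)
  ultimately show ?thesis
    unfolding rational_solutions_iff_difference_of_squares y_def [symmetric] z_def [symmetric]
      y2 z2 [symmetric]
    using assms(5) by simp
qed

lemma eq_sign_times_abs:
  fixes a :: rat
  obtains s where "s \<in> {1, -1}" "a = s * \<bar>a\<bar>"
  by (cases "a \<ge> 0") force+

section \<open>Description of all rational solutions\<close>

theorem theorem13:
  fixes n :: nat
  assumes "n > 0"
  shows
    "((\<nexists>k::nat. n = k^2) \<longrightarrow>
        \<not> (\<exists>x y z. (x, y, z) \<in> rational_solutions n \<and> y * z = 0))
     \<and> (\<forall>k::nat. k > 0 \<and> n = k^2 \<longrightarrow>
        {(x, y, z). (x, y, z) \<in> rational_solutions n \<and> y * z = 0} =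
          {(s * of_nat k, 0, 0) | s :: rat. s \<in> {1, -1}}
          \<union> {(r^2 + s * of_nat k, s' * r, 0) | r s s' :: rat.
               r > 0 \<and> s \<in> {1, -1} \<and> s' \<in> {1, -1}}
          \<union> {(r^2 + s * of_nat k, 0, s' * r) | r s s' :: rat.
               r > 0 \<and> s \<in> {1, -1} \<and> s' \<in> {1, -1}})
     \<and> {(x, y, z). (x, y, z) \<in> rational_solutions n \<and> y * z \<noteq> 0} =
          {(r^2 + 1 / (16 * r^2)
                  * (of_nat n1 * of_nat t1 / of_nat t2 - of_nat n2 * of_nat t2 / of_nat t1)^2
                + s * (1 / 2)
                  * (of_nat n1 * of_nat t1 / of_nat t2 + of_nat n2 * of_nat t2 / of_nat t1),
            s' * r,
            s'' * (1 / (4 * r))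
                * \<bar>of_nat n1 * of_nat t1 / of_nat t2 - of_nat n2 * of_nat t2 / of_nat t1\<bar>)
           | (r :: rat) (s :: rat) (s' :: rat) (s'' :: rat)
             (n1 :: nat) (t1 :: nat) (n2 :: nat) (t2 :: nat).
             r > 0 \<and> s \<in> {1, -1} \<and> s' \<in> {1, -1} \<and> s'' \<in> {1, -1}
             \<and> n1 > 0 \<and> t1 > 0 \<and> n2 > 0 \<and> t2 > 0
             \<and> n1 * n2 = n \<and> gcd t1 t2 = 1 \<and> n1 * t1^2 \<noteq> n2 * t2^2}"
proof (intro conjI impI allI)
  assume nonsquare: "\<nexists>k::nat. n = k^2"
  show "\<not> (\<exists>x y z. (x, y, z) \<in> rational_solutions n \<and> y * z = 0)"
  proof clarify
    fix x y z :: rat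
    assume "(x, y, z) \<in> rational_solutions n" "y * z = 0"
    then have "(x - y^2 - z^2)^2 = of_nat n"
      by (simp add: rational_solutions_iff_difference_of_squares)
    then show False
      using nat_eq_square_if_rat_square nonsquare by blast
  qed
next
  fix k :: nat
  assume "k > 0 \<and> n = k^2"
  then have n: "n = k^2" by simp
  show "{(x, y, z). (x, y, z) \<in> rational_solutions n \<and> y * z = 0} =
          {(s * of_nat k, 0, 0) | s :: rat. s \<in> {1, -1}}
          \<union> {(r^2 + s * of_nat k, s' * r, 0) | r s s' :: rat.
               r > 0 \<and> s \<in> {1, -1} \<and> s' \<in> {1, -1}}
          \<union> {(r^2 + s * of_nat k, 0, s' * r) | r s s' :: rat.
               r > 0 \<and> s \<in> {1, -1} \<and> s' \<in> {1, -1}}" (is "?L = ?O \<union> ?Y \<union> ?Z")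
  proof (intro equalityI subsetI)
    fix p
    assume "p \<in> ?L"
    then obtain x y z where p: "p = (x, y, z)" and yz: "y * z = 0"
      and "(x, y, z) \<in> rational_solutions (k^2)"
      using n by auto
    then have "x = y^2 + z^2 + of_nat k \<or> x = y^2 + z^2 - of_nat k"
      by (simp add: rational_solutions_square_axis_iff)
    then obtain s :: rat where s: "s \<in> {1, -1}" and x: "x = y^2 + z^2 + s * of_nat k"
      by force
    obtain sy where sy: "sy \<in> {1, -1}" "y = sy * \<bar>y\<bar>"
      by (rule eq_sign_times_abs)
    obtain sz where sz: "sz \<in> {1, -1}" "z = sz * \<bar>z\<bar>"
      by (rule eq_sign_times_abs)
    consider "y = 0" "z = 0" | "y \<noteq> 0" "z = 0" | "y = 0" "z \<noteq> 0"
      using yz by auto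
    then show "p \<in> ?O \<union> ?Y \<union> ?Z"
    proof cases
      case 1
      then have "p \<in> ?O"
        using p x s by auto
      then show ?thesis by blast
    next
      case 2
      then have "p = (\<bar>y\<bar>^2 + s * of_nat k, sy * \<bar>y\<bar>, 0)" "\<bar>y\<bar> > 0"
        using p x sy(2) by simp_all
      then have "p \<in> ?Y"
        using s sy(1) by blast
      then show ?thesis by blast
    next
      case 3
      then have "p = (\<bar>z\<bar>^2 + s * of_nat k, 0, sz * \<bar>z\<bar>)" "\<bar>z\<bar> > 0"
        using p x sz(2) by simp_all
      then have "p \<in> ?Z"
        using s sz(1) by blast
      then show ?thesis by blast
    qed
  next
    fix p
    assume "p \<in> ?O \<union> ?Y \<union> ?Z"
    then show "p \<in> ?L"
      unfolding n by (auto simp: rational_solutions_square_axis_iff)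
  qed
next
  show "{(x, y, z). (x, y, z) \<in> rational_solutions n \<and> y * z \<noteq> 0} =
          {(r^2 + 1 / (16 * r^2)
                  * (of_nat n1 * of_nat t1 / of_nat t2 - of_nat n2 * of_nat t2 / of_nat t1)^2
                + s * (1 / 2)
                  * (of_nat n1 * of_nat t1 / of_nat t2 + of_nat n2 * of_nat t2 / of_nat t1),
            s' * r,
            s'' * (1 / (4 * r))
                * \<bar>of_nat n1 * of_nat t1 / of_nat t2 - of_nat n2 * of_nat t2 / of_nat t1\<bar>)
           | (r :: rat) (s :: rat) (s' :: rat) (s'' :: rat)
             (n1 :: nat) (t1 :: nat) (n2 :: nat) (t2 :: nat).
             r > 0 \<and> s \<in> {1, -1} \<and> s' \<in> {1, -1} \<and> s'' \<in> {1, -1}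
             \<and> n1 > 0 \<and> t1 > 0 \<and> n2 > 0 \<and> t2 > 0
             \<and> n1 * n2 = n \<and> gcd t1 t2 = 1 \<and> n1 * t1^2 \<noteq> n2 * t2^2}" (is "?L = ?R")
  proof (intro equalityI subsetI)
    fix p
    assume "p \<in> ?L"
    then obtain x y z where p: "p = (x, y, z)" and yz: "y * z \<noteq> 0"
      and "(x, y, z) \<in> rational_solutions n"
      by auto
    then have "(x - y^2 - z^2)^2 - (2 * (y * z))^2 = of_nat n" "2 * (y * z) \<noteq> 0"
      by (simp_all add: rational_solutions_iff_difference_of_squares)
    with assms obtain t1 t2 :: nat where t: "t1 > 0" "t2 > 0" "coprime t1 t2" "n * t1^2 \<noteq> t2^2"
      and w: "\<bar>x - y^2 - z^2\<bar> = (of_nat n * of_nat t1 / of_nat t2 + of_nat t2 / of_nat t1) / 2"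
      and v: "\<bar>2 * (y * z)\<bar> = \<bar>of_nat n * of_nat t1 / of_nat t2 - of_nat t2 / of_nat t1\<bar> / 2"
      by (rule difference_of_squares_factors)
    \<comment> \<open>The factor \<open>of_nat 1\<close> plays \<open>n\<^sub>2\<close>, so that \<open>B\<close> has the shape of the parametrization.\<close>
    define A B :: rat where "A = of_nat n * of_nat t1 / of_nat t2"
      and "B = of_nat 1 * of_nat t2 / of_nat t1"
    have r: "\<bar>y\<bar> > 0"
      using yz by simp
    obtain s where s: "s \<in> {1, -1}" "x - y^2 - z^2 = s * \<bar>x - y^2 - z^2\<bar>"
      by (rule eq_sign_times_abs)
    obtain s' where s': "s' \<in> {1, -1}" "y = s' * \<bar>y\<bar>"
      by (rule eq_sign_times_abs)
    obtain s'' where s'': "s'' \<in> {1, -1}" "z = s'' * \<bar>z\<bar>"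
      by (rule eq_sign_times_abs)
    have abs_z: "\<bar>z\<bar> = 1 / (4 * \<bar>y\<bar>) * \<bar>A - B\<bar>"
      using v r by (simp add: A_def B_def abs_mult field_simps)
    have "z^2 = (1 / (4 * \<bar>y\<bar>) * \<bar>A - B\<bar>)^2"
      unfolding abs_z [symmetric] by simp
    then have z2: "z^2 = 1 / (16 * \<bar>y\<bar>^2) * (A - B)^2"
      by (simp add: power_mult_distrib power_divide)
    have "x - y^2 - z^2 = s * (1 / 2) * (A + B)"
      using s(2) unfolding w by (simp add: A_def B_def)
    then have x: "x = \<bar>y\<bar>^2 + 1 / (16 * \<bar>y\<bar>^2) * (A - B)^2 + s * (1 / 2) * (A + B)"
      unfolding z2 [symmetric] by (simp only: power2_abs)
    have z: "z = s'' * (1 / (4 * \<bar>y\<bar>)) * \<bar>A - B\<bar>"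
      using s''(2) unfolding abs_z by (simp only: mult.assoc)
    have side: "n * 1 = n" "gcd t1 t2 = 1" "n * t1^2 \<noteq> 1 * t2^2" "(1::nat) > 0"
      using t by (simp_all add: coprime_iff_gcd_eq_1)
    have "p = (\<bar>y\<bar>^2 + 1 / (16 * \<bar>y\<bar>^2) * (A - B)^2 + s * (1 / 2) * (A + B),
        s' * \<bar>y\<bar>, s'' * (1 / (4 * \<bar>y\<bar>)) * \<bar>A - B\<bar>)"
      using p x s'(2) z by blast
    note p_eq = this [unfolded A_def B_def]
    show "p \<in> ?R"
      by (rule CollectI, intro exI conjI, rule p_eq)
        (rule r s(1) s'(1) s''(1) assms t(1,2) side)+
  next
    fix p
    assume "p \<in> ?R"
    then obtain r s s' s'' :: rat and n1 t1 n2 t2 :: nat where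
      p: "p = (r^2 + 1 / (16 * r^2)
                  * (of_nat n1 * of_nat t1 / of_nat t2 - of_nat n2 * of_nat t2 / of_nat t1)^2
                + s * (1 / 2)
                  * (of_nat n1 * of_nat t1 / of_nat t2 + of_nat n2 * of_nat t2 / of_nat t1),
            s' * r,
            s'' * (1 / (4 * r))
                * \<bar>of_nat n1 * of_nat t1 / of_nat t2 - of_nat n2 * of_nat t2 / of_nat t1\<bar>)"
      and r: "r > 0" and s: "s \<in> {1, -1}" "s' \<in> {1, -1}" "s'' \<in> {1, -1}"
      and t: "t1 > 0" "t2 > 0" and n: "n1 * n2 = n" and ne: "n1 * t1^2 \<noteq> n2 * t2^2"
      by blast
    define A B :: rat where "A = of_nat n1 * of_nat t1 / of_nat t2"
      and "B = of_nat n2 * of_nat t2 / of_nat t1"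
    have "A * B = of_nat n"
      using t n by (auto simp: A_def B_def)
    note sol = factors_give_rational_solution [OF r s this]
    have "A \<noteq> B"
    proof
      assume "A = B"
      then have "of_nat (n1 * t1^2) = (of_nat (n2 * t2^2) :: rat)"
        using t by (simp add: A_def B_def field_simps power2_eq_square)
      then show False
        using ne by (simp only: of_nat_eq_iff)
    qed
    then have "s' * r * (s'' * (1 / (4 * r)) * \<bar>A - B\<bar>) \<noteq> 0"
      using r s by auto
    then show "p \<in> ?L"
      using sol unfolding p A_def B_def by blast
  qed
qed

end
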